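(* Let $R$ be an integral domain with fraction field $K$. Consider the following statements: (1) $R$ is anti-Archimedean, i.e. every nonzero $r \in R$ satisfies $\bigcap_{n=1}^{\infty} r^n R \neq (0)$; (2) $K$ is strongly simple over $R$; (3) $R$ does not have a prime ideal of height one. Then (1) $\Rightarrow$ (2) $\Rightarrow$ (3).
   Context: A Mathieu subspace of $K$ over $R$ is an $R$-submodule $M$ of $K$ such that for all $a, b \in K$: if $a^m \in M$ for all $m \ge 1$, then $b a^m \in M$ for all sufficiently large $m$. The $R$-algebra $K$ is called strongly simple over $R$ if it has no proper nonzero Mathieu subspaces over $R$, i.e. the only Mathieu subspaces of $K$ over $R$ are $0$ and $K$. *)

theory Defs
  imports "HOL-Algebra.Algebra" "HOL-Library.Extended_Nat"
begin

text \<open>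
  The structure map of an \<open>R\<close>-algebra \<open>K\<close> sends \<open>r\<close> to \<open>r \<odot> \<one>\<close>.  A fraction field of an
  integral domain \<open>R\<close> is a field \<open>K\<close> that is an \<open>R\<close>-algebra whose structure map is injective and
  in which every element is a quotient of images of elements of \<open>R\<close>.
\<close>

definition is_fraction_field ::
    "('a, 'c) ring_scheme \<Rightarrow> ('a, 'b, 'd) module_scheme \<Rightarrow> bool" where
  "is_fraction_field R K \<longleftrightarrow>
     field K \<and> algebra R K \<and>
     inj_on (\<lambda>r. r \<odot>\<^bsub>K\<^esub> \<one>\<^bsub>K\<^esub>) (carrier R) \<and>
     (\<forall>x \<in> carrier K. \<exists>a \<in> carrier R. \<exists>b \<in> carrier R - {\<zero>\<^bsub>R\<^esub>}.
        x = (a \<odot>\<^bsub>K\<^esub> \<one>\<^bsub>K\<^esub>) \<otimes>\<^bsub>K\<^esub> inv\<^bsub>K\<^esub> (b \<odot>\<^bsub>K\<^esub> \<one>\<^bsub>K\<^esub>))"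

definition anti_Archimedean :: "('a, 'c) ring_scheme \<Rightarrow> bool" where
  "anti_Archimedean R \<longleftrightarrow>
     (\<forall>r \<in> carrier R - {\<zero>\<^bsub>R\<^esub>}. (\<Inter>n \<in> {1::nat..}. PIdl\<^bsub>R\<^esub> (r [^]\<^bsub>R\<^esub> n)) \<noteq> {\<zero>\<^bsub>R\<^esub>})"

definition mathieu_subspace ::
    "('a, 'c) ring_scheme \<Rightarrow> ('a, 'b, 'd) module_scheme \<Rightarrow> 'b set \<Rightarrow> bool" where
  "mathieu_subspace R K M \<longleftrightarrow>
     submodule M R K \<and>
     (\<forall>a \<in> carrier K. \<forall>b \<in> carrier K.
        (\<forall>m::nat. m \<ge> 1 \<longrightarrow> a [^]\<^bsub>K\<^esub> m \<in> M) \<longrightarrow>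
        (\<exists>N::nat. \<forall>m\<ge>N. b \<otimes>\<^bsub>K\<^esub> (a [^]\<^bsub>K\<^esub> m) \<in> M))"

definition strongly_simple ::
    "('a, 'c) ring_scheme \<Rightarrow> ('a, 'b, 'd) module_scheme \<Rightarrow> bool" where
  "strongly_simple R K \<longleftrightarrow>
     (\<forall>M. mathieu_subspace R K M \<longrightarrow> M = {\<zero>\<^bsub>K\<^esub>} \<or> M = carrier K)"

text \<open>
  The height of a prime ideal \<open>P\<close> is the supremum of the lengths \<open>n\<close> of strictly increasing chains
  \<open>C 0 \<subset> \<dots> \<subset> C n = P\<close> of prime ideals; the values of \<open>C\<close> beyond \<open>n\<close> are irrelevant.
\<close>

definition prime_chain :: "('a, 'c) ring_scheme \<Rightarrow> 'a set \<Rightarrow> nat \<Rightarrow> (nat \<Rightarrow> 'a set) \<Rightarrow> bool" where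
  "prime_chain R P n C \<longleftrightarrow>
     (\<forall>i\<le>n. primeideal (C i) R) \<and> (\<forall>i<n. C i \<subset> C (Suc i)) \<and> C n = P"

definition height :: "('a, 'c) ring_scheme \<Rightarrow> 'a set \<Rightarrow> enat" where
  "height R P = (SUP n \<in> {n. \<exists>C. prime_chain R P n C}. enat n)"

end

theory Submission
  imports Defs
begin

text \<open>
  Let \<open>M \<noteq> 0\<close> be a Mathieu subspace of \<open>K\<close>.  Clearing the denominator of a nonzero element
  of \<open>M\<close> gives a nonzero \<open>u \<in> R \<inter> M\<close>, and all powers \<open>u\<^sup>m = u\<^sup>m\<^sup>-\<^sup>1 u\<close> with \<open>m \<ge> 1\<close> then
  lie in \<open>M\<close> as well.  If \<open>R\<close> is anti-Archimedean, some \<open>s \<noteq> 0\<close> is divisible by every power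
  of \<open>u\<close>, say \<open>s = r\<^sub>m u\<^sup>m\<close>.  For \<open>y \<in> K\<close> the Mathieu condition, applied with \<open>a = u\<close> and
  \<open>b = y / s\<close>, puts \<open>(y / s) u\<^sup>m\<close> in \<open>M\<close> for large \<open>m\<close>, and multiplication by \<open>r\<^sub>m\<close> gives
  \<open>y \<in> M\<close>.  Hence \<open>M = K\<close>.

  The second implication is proved by contraposition.  Let \<open>P\<close> be a prime of height one.  The maximal ideal \<open>P R\<^sub>P\<close> of the localization
  \<open>R\<^sub>P \<subseteq> K\<close> is an \<open>R\<close>-submodule that is neither \<open>0\<close> (as \<open>P \<noteq> 0\<close>) nor \<open>K\<close> (it misses \<open>1\<close>).
  It is a Mathieu subspace because \<open>P R\<^sub>P\<close> is the only nonzero prime of \<open>R\<^sub>P\<close>: each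
  \<open>a \<in> P R\<^sub>P\<close> lies in the radical of \<open>v R\<^sub>P\<close> for every nonzero \<open>v \<in> R\<close>, so a high power of
  \<open>a\<close> absorbs the denominator \<open>v\<close> of any given \<open>b \<in> K\<close> and \<open>b a\<^sup>m\<close> falls into \<open>P R\<^sub>P\<close>.  The
  radical statement, with its denominators cleared, is \<open>height_one_power_multiple\<close>; it rests on
  Krull's existence theorem for primes disjoint from a multiplicative set
  (\<open>exists_primeideal_avoiding\<close>).
\<close>

section \<open>Prime ideals avoiding a multiplicative set\<close>

lemma (in primeideal) one_notin: "\<one> \<notin> I"
  using I_notcarr one_imp_carrier by auto

text \<open>
  If \<open>a\<close> and \<open>b\<close> lie outside \<open>Q\<close>, maximality makes both \<open>Q + aR\<close> and \<open>Q + bR\<close> meet \<open>S\<close>.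
  The product of the two common elements is in \<open>S\<close> and in \<open>Q + abR\<close>, so \<open>ab\<close> cannot be in \<open>Q\<close>.
\<close>

lemma (in cring) primeideal_if_maximal_avoiding:
  assumes S: "submonoid S R"
    and Q: "ideal Q R" "Q \<inter> S = {}"
    and max: "\<And>J. ideal J R \<Longrightarrow> Q \<subseteq> J \<Longrightarrow> J \<inter> S = {} \<Longrightarrow> J = Q"
  shows "primeideal Q R"
proof -
  interpret S: submonoid S R by (rule S)
  interpret Q: ideal Q R by (rule Q)
  have meets: "\<exists>q\<in>Q. \<exists>x\<in>carrier R. q \<oplus> x \<otimes> a \<in> S" if a: "a \<in> carrier R" "a \<notin> Q" for a
  proof -
    let ?J = "Q <+>\<^bsub>R\<^esub> PIdl a"
    have J: "ideal ?J R"
      using Q.is_ideal cgenideal_ideal[OF a(1)] by (rule add_ideals)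
    have mem: "q \<oplus> x \<otimes> a \<in> ?J" if "q \<in> Q" "x \<in> carrier R" for q x
      using that unfolding set_add_def' cgenideal_def by blast
    have "Q \<subseteq> ?J"
    proof
      fix q assume "q \<in> Q"
      then show "q \<in> ?J" using mem[of q \<zero>] a(1) by simp
    qed
    moreover have "a \<in> ?J" using mem[of \<zero> \<one>] a(1) by simp
    ultimately have "?J \<inter> S \<noteq> {}" using max[OF J] a(2) by blast
    then show ?thesis unfolding set_add_def' cgenideal_def by blast
  qed
  show ?thesis
  proof (rule primeidealI)
    show "ideal Q R" by (rule Q.is_ideal)
    show "cring R" by (rule is_cring)
    show "carrier R \<noteq> Q" using Q(2) S.one_closed by auto
  next
    fix a b assume a: "a \<in> carrier R" and b: "b \<in> carrier R" and ab: "a \<otimes> b \<in> Q"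
    show "a \<in> Q \<or> b \<in> Q"
    proof (rule ccontr)
      assume "\<not> (a \<in> Q \<or> b \<in> Q)"
      then obtain q x r y where q: "q \<in> Q" and x: "x \<in> carrier R" and s: "q \<oplus> x \<otimes> a \<in> S"
        and r: "r \<in> Q" and y: "y \<in> carrier R" and t: "r \<oplus> y \<otimes> b \<in> S"
        using meets[OF a] meets[OF b] by blast
      have qc: "q \<in> carrier R" and rc: "r \<in> carrier R" using q r Q.Icarr by auto
      have "(q \<oplus> x \<otimes> a) \<otimes> (r \<oplus> y \<otimes> b)
          = q \<otimes> (r \<oplus> y \<otimes> b) \<oplus> (x \<otimes> a) \<otimes> r \<oplus> (x \<otimes> y) \<otimes> (a \<otimes> b)"
        using a b x y qc rc by (simp add: l_distr r_distr a_ac m_ac)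
      also have "\<dots> \<in> Q"
        using a b x y q r rc ab
        by (simp add: Q.a_closed Q.I_r_closed Q.I_l_closed)
      finally show False using S.m_closed[OF s t] Q(2) by blast
    qed
  qed
qed

text \<open>
  Krull's theorem: Zorn's lemma applies to the ideals above \<open>I\<close> that avoid \<open>S\<close>, since the union
  of a chain of them is again one.
\<close>

lemma (in cring) exists_primeideal_avoiding:
  assumes S: "submonoid S R" and I: "ideal I R" and disj: "I \<inter> S = {}"
  obtains Q where "primeideal Q R" "I \<subseteq> Q" "Q \<inter> S = {}"
proof -
  let ?A = "{J. ideal J R \<and> I \<subseteq> J \<and> J \<inter> S = {}}"
  have "\<exists>Q\<in>?A. \<forall>J\<in>?A. Q \<subseteq> J \<longrightarrow> J = Q"
  proof (rule subset_Zorn_nonempty)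
    show "?A \<noteq> {}" using I disj by blast
  next
    fix \<C> assume ne: "\<C> \<noteq> {}" and ch: "subset.chain ?A \<C>"
    then have sub: "\<C> \<subseteq> ?A" by (simp add: pred_on.chain_def)
    have "subset.chain {J. ideal J R} \<C>"
      using ch unfolding pred_on.chain_def by blast
    from chain_Union_is_ideal[OF this] have "ideal (\<Union>\<C>) R" using ne by simp
    then show "\<Union>\<C> \<in> ?A" using ne sub by blast
  qed
  then obtain Q where "Q \<in> ?A" and max: "\<forall>J\<in>?A. Q \<subseteq> J \<longrightarrow> J = Q"
    by (rule bexE)
  then have Q: "ideal Q R" "I \<subseteq> Q" "Q \<inter> S = {}" by simp_all
  have "primeideal Q R"
  proof (rule primeideal_if_maximal_avoiding[OF S Q(1,3)])
    fix J assume "ideal J R" "Q \<subseteq> J" "J \<inter> S = {}"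
    with Q(2) show "J = Q" by (intro max[rule_format]) auto
  qed
  then show thesis using Q(2,3) by (rule that)
qed

section \<open>Primes of height one\<close>

lemma (in domain) height_one_nonzero:
  assumes ht: "height R P = 1"
  shows "P \<noteq> {\<zero>}"
proof
  assume P: "P = {\<zero>}"
  have "n = 0" if "prime_chain R P n C" for n C
  proof (rule ccontr)
    assume "n \<noteq> 0"
    then obtain k where k: "n = Suc k" by (cases n) auto
    have "C k \<subset> {\<zero>}" "primeideal (C k) R"
      using that P unfolding prime_chain_def k by auto
    moreover have "\<zero> \<in> C k"
      using \<open>primeideal (C k) R\<close>
      by (simp add: additive_subgroup.zero_closed ideal.axioms(1) primeideal.axioms(1))
    ultimately show False by blast
  qed
  then have "height R P \<le> 0"
    unfolding height_def by (intro SUP_least) (auto simp: zero_enat_def)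
  with ht show False by simp
qed

text \<open>
  In a domain \<open>{\<zero>}\<close> is prime, so a prime strictly between \<open>{\<zero>}\<close> and \<open>P\<close> would give a chain of
  length two.
\<close>

lemma (in domain) height_one_minimal:
  assumes P: "primeideal P R" and ht: "height R P = 1"
    and Q: "primeideal Q R" "Q \<subseteq> P" "Q \<noteq> {\<zero>}"
  shows "Q = P"
proof (rule ccontr)
  assume "Q \<noteq> P"
  have "\<zero> \<in> Q"
    using Q(1) by (simp add: additive_subgroup.zero_closed ideal.axioms(1) primeideal.axioms(1))
  define C where "C = (\<lambda>i::nat. if i = 0 then {\<zero>} else if i = 1 then Q else P)"
  have "prime_chain R P 2 C"
    unfolding prime_chain_def
  proof (intro conjI allI impI)
    show "primeideal (C i) R" for i
      using P Q(1) zeroprimeideal by (simp add: C_def)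
    show "C i \<subset> C (Suc i)" if "i < 2" for i
      using that Q \<open>Q \<noteq> P\<close> \<open>\<zero> \<in> Q\<close> by (cases i) (auto simp: C_def)
    show "C 2 = P" by (simp add: C_def)
  qed
  then have "enat 2 \<le> height R P"
    unfolding height_def by (intro SUP_upper) blast
  with ht show False by (simp add: one_enat_def)
qed

text \<open>
  This says that \<open>p\<close> lies in the radical of \<open>v R\<^sub>P\<close>.  Otherwise \<open>vR\<close> would avoid the
  multiplicative set of all \<open>t p\<^sup>n\<close> with \<open>t \<notin> P\<close>, and so would some prime \<open>Q \<supseteq> vR\<close>.  Avoiding the
  elements \<open>t\<close> (\<open>n = 0\<close>) forces \<open>Q \<subseteq> P\<close>, hence \<open>Q = P\<close> by height one; but \<open>Q\<close> also avoids
  \<open>p \<in> P\<close>.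
\<close>

lemma (in domain) height_one_power_multiple:
  assumes P: "primeideal P R" and ht: "height R P = 1"
    and p: "p \<in> P" and v: "v \<in> carrier R" "v \<noteq> \<zero>"
  obtains t n r where "t \<in> carrier R - P" "r \<in> carrier R" "t \<otimes> p [^] (n::nat) = r \<otimes> v"
proof -
  interpret P: primeideal P R by (rule P)
  have pc: "p \<in> carrier R" using p by (rule P.Icarr)
  define S where "S = {t \<otimes> p [^] n | t (n::nat). t \<in> carrier R - P}"
  have S_mem: "t \<otimes> p [^] n \<in> S" if "t \<in> carrier R - P" for t and n :: nat
    using that unfolding S_def by blast
  have one: "\<one> \<in> carrier R - P"
    using P.one_notin by simp
  have "submonoid S R"
  proof
    show "S \<subseteq> carrier R" unfolding S_def using pc by auto
    show "\<one> \<in> S" using S_mem[OF one, of 0] by simp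
  next
    fix x y assume "x \<in> S" "y \<in> S"
    then obtain s t and m n :: nat where st: "s \<in> carrier R - P" "t \<in> carrier R - P"
      and xy: "x = s \<otimes> p [^] m" "y = t \<otimes> p [^] n"
      unfolding S_def by blast
    have "x \<otimes> y = (s \<otimes> t) \<otimes> p [^] (m + n)"
      using st pc unfolding xy by (simp add: nat_pow_mult[symmetric] m_ac)
    moreover have "s \<otimes> t \<in> carrier R - P"
      using st P.I_prime by blast
    ultimately show "x \<otimes> y \<in> S" using S_mem by simp
  qed
  have "PIdl v \<inter> S \<noteq> {}"
  proof
    assume "PIdl v \<inter> S = {}"
    with \<open>submonoid S R\<close> cgenideal_ideal[OF v(1)]
    obtain Q where Q: "primeideal Q R" "PIdl v \<subseteq> Q" "Q \<inter> S = {}"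
      by (rule exists_primeideal_avoiding)
    have "v \<in> Q" using Q(2) cgenideal_self[OF v(1)] by blast
    then have "Q \<noteq> {\<zero>}" using v(2) by blast
    have Qc: "Q \<subseteq> carrier R"
      using Q(1) by (simp add: additive_subgroup.a_subset ideal.axioms(1) primeideal.axioms(1))
    have "Q \<subseteq> P"
    proof
      fix t assume "t \<in> Q"
      show "t \<in> P"
      proof (rule ccontr)
        assume "t \<notin> P"
        then have "t \<in> S" using S_mem[of t 0] \<open>t \<in> Q\<close> Qc by auto
        with \<open>t \<in> Q\<close> Q(3) show False by blast
      qed
    qed
    then have "Q = P"
      using height_one_minimal[OF P ht Q(1)] \<open>Q \<noteq> {\<zero>}\<close> by blast
    moreover have "p \<in> S" using S_mem[OF one, of 1] pc by simp
    ultimately show False using p Q(3) by blast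
  qed
  then obtain t n r where "t \<in> carrier R - P" "r \<in> carrier R" "r \<otimes> v = t \<otimes> p [^] (n::nat)"
    unfolding S_def cgenideal_def by blast
  then show thesis using that[of t r n] by simp
qed

section \<open>Fraction fields\<close>

locale fraction_field = domain R + K: field K + A: algebra R K
  for R :: "('a, 'c) ring_scheme" (structure) and K :: "('a, 'b, 'd) module_scheme" (structure) +
  assumes inj: "inj_on (\<lambda>r. r \<odot>\<^bsub>K\<^esub> \<one>\<^bsub>K\<^esub>) (carrier R)"
    and quotient: "x \<in> carrier K \<Longrightarrow> \<exists>a \<in> carrier R. \<exists>b \<in> carrier R - {\<zero>}.
        x = (a \<odot>\<^bsub>K\<^esub> \<one>\<^bsub>K\<^esub>) \<otimes>\<^bsub>K\<^esub> inv\<^bsub>K\<^esub> (b \<odot>\<^bsub>K\<^esub> \<one>\<^bsub>K\<^esub>)"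
begin

abbreviation emb :: "'a \<Rightarrow> 'b" where "emb r \<equiv> r \<odot>\<^bsub>K\<^esub> \<one>\<^bsub>K\<^esub>"

lemma smult_eq_mult: "r \<in> carrier R \<Longrightarrow> x \<in> carrier K \<Longrightarrow> r \<odot>\<^bsub>K\<^esub> x = emb r \<otimes>\<^bsub>K\<^esub> x"
  by (simp add: A.smult_assoc2)

lemma emb_mult: "r \<in> carrier R \<Longrightarrow> s \<in> carrier R \<Longrightarrow> emb (r \<otimes> s) = emb r \<otimes>\<^bsub>K\<^esub> emb s"
  by (simp add: A.smult_assoc1 A.smult_assoc2)

lemma emb_pow: "r \<in> carrier R \<Longrightarrow> emb (r [^] (n::nat)) = emb r [^]\<^bsub>K\<^esub> n"
  by (induction n) (simp_all add: emb_mult)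

lemma emb_nonzero: "r \<in> carrier R \<Longrightarrow> r \<noteq> \<zero> \<Longrightarrow> emb r \<in> Units K"
  using inj_onD[OF inj, of r \<zero>] by (auto simp: K.field_Units)

lemma smult_surjective:
  assumes "s \<in> carrier R" "s \<noteq> \<zero>" "y \<in> carrier K"
  obtains b where "b \<in> carrier K" "s \<odot>\<^bsub>K\<^esub> b = y"
proof
  have u: "emb s \<in> Units K" using assms emb_nonzero by blast
  show c: "inv\<^bsub>K\<^esub> emb s \<otimes>\<^bsub>K\<^esub> y \<in> carrier K" using u assms by simp
  have "s \<odot>\<^bsub>K\<^esub> (inv\<^bsub>K\<^esub> emb s \<otimes>\<^bsub>K\<^esub> y) = emb s \<otimes>\<^bsub>K\<^esub> (inv\<^bsub>K\<^esub> emb s \<otimes>\<^bsub>K\<^esub> y)"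
    using assms(1) c by (rule smult_eq_mult)
  also have "\<dots> = (emb s \<otimes>\<^bsub>K\<^esub> inv\<^bsub>K\<^esub> emb s) \<otimes>\<^bsub>K\<^esub> y"
    using u assms by (intro K.m_assoc[symmetric]) auto
  also have "\<dots> = y" using u assms by simp
  finally show "s \<odot>\<^bsub>K\<^esub> (inv\<^bsub>K\<^esub> emb s \<otimes>\<^bsub>K\<^esub> y) = y" .
qed

lemma exists_denominator:
  assumes "x \<in> carrier K"
  obtains u v where "u \<in> carrier R" "v \<in> carrier R" "v \<noteq> \<zero>" "v \<odot>\<^bsub>K\<^esub> x = emb u"
proof -
  obtain u v where uv: "u \<in> carrier R" "v \<in> carrier R" "v \<noteq> \<zero>"
    and x: "x = emb u \<otimes>\<^bsub>K\<^esub> inv\<^bsub>K\<^esub> emb v"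
    using quotient[OF assms] by blast
  have unit: "emb v \<in> Units K" using uv emb_nonzero by blast
  have "v \<odot>\<^bsub>K\<^esub> x = emb v \<otimes>\<^bsub>K\<^esub> (emb u \<otimes>\<^bsub>K\<^esub> inv\<^bsub>K\<^esub> emb v)"
    using uv(2) assms unfolding x by (rule smult_eq_mult)
  also have "\<dots> = emb u \<otimes>\<^bsub>K\<^esub> (emb v \<otimes>\<^bsub>K\<^esub> inv\<^bsub>K\<^esub> emb v)"
    using uv unit by (intro K.m_lcomm) auto
  also have "\<dots> = emb u" using uv unit by simp
  finally show thesis using uv that by blast
qed

section \<open>Anti-Archimedean domains\<close>

lemma anti_Archimedean_imp_strongly_simple:
  assumes "anti_Archimedean R"
  shows "strongly_simple R K"
  unfolding strongly_simple_def
proof (intro allI impI)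
  fix M assume M: "mathieu_subspace R K M"
  then have sub: "submodule M R K" by (simp add: mathieu_subspace_def)
  note subE = A.submoduleE[OF sub]
  show "M = {\<zero>\<^bsub>K\<^esub>} \<or> M = carrier K"
  proof (rule disjCI)
    assume "M \<noteq> carrier K"
    show "M = {\<zero>\<^bsub>K\<^esub>}"
    proof (rule ccontr)
      assume "M \<noteq> {\<zero>\<^bsub>K\<^esub>}"
      then obtain x where x: "x \<in> M" "x \<noteq> \<zero>\<^bsub>K\<^esub>" using subE(2) by blast
      then have xc: "x \<in> carrier K" using subE(1) by blast
      obtain u v where u: "u \<in> carrier R" and v: "v \<in> carrier R" "v \<noteq> \<zero>"
        and vx: "v \<odot>\<^bsub>K\<^esub> x = emb u"
        using xc by (rule exists_denominator)
      have uM: "emb u \<in> M" using subE(4)[OF v(1) x(1)] vx by simp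
      have "emb v \<otimes>\<^bsub>K\<^esub> x \<noteq> \<zero>\<^bsub>K\<^esub>"
        using emb_nonzero[OF v] x(2) xc K.integral by (auto simp: K.field_Units)
      then have u0: "u \<noteq> \<zero>" using vx smult_eq_mult[OF v(1) xc] by auto
      have powM: "\<forall>m::nat. m \<ge> 1 \<longrightarrow> emb u [^]\<^bsub>K\<^esub> m \<in> M"
      proof (intro allI impI)
        fix m :: nat assume "m \<ge> 1"
        then obtain k where k: "m = Suc k" by (cases m) auto
        have "emb u [^]\<^bsub>K\<^esub> m = (u [^] k) \<odot>\<^bsub>K\<^esub> emb u"
          using u unfolding k by (simp add: emb_pow[symmetric] A.smult_assoc1 emb_mult smult_eq_mult[of _ "emb u"])
        then show "emb u [^]\<^bsub>K\<^esub> m \<in> M" using subE(4)[OF _ uM] u by simp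
      qed
      have "(\<Inter>n \<in> {1::nat..}. PIdl (u [^] n)) \<noteq> {\<zero>}"
        using assms u u0 unfolding anti_Archimedean_def by blast
      moreover have "\<zero> \<in> (\<Inter>n \<in> {1::nat..}. PIdl (u [^] n))"
        using u by (auto simp: cgenideal_def intro!: exI[of _ \<zero>])
      ultimately obtain s where s: "s \<in> (\<Inter>n \<in> {1::nat..}. PIdl (u [^] n))" "s \<noteq> \<zero>"
        by blast
      have sdiv: "\<exists>r\<in>carrier R. s = r \<otimes> u [^] n" if "n \<ge> 1" for n :: nat
        using s(1) that unfolding cgenideal_def by auto
      then have sc: "s \<in> carrier R" using u by fastforce
      have "y \<in> M" if y: "y \<in> carrier K" for y
      proof -
        obtain b where b: "b \<in> carrier K" "s \<odot>\<^bsub>K\<^esub> b = y"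
          using sc s(2) y by (rule smult_surjective)
        \<comment> \<open>The Mathieu condition is applied to \<open>b = y / s\<close>, not to \<open>y\<close>: the surplus factor \<open>1 / s\<close>
          is what cancels the power of \<open>u\<close>.\<close>
        obtain N :: nat where N: "\<And>m. m \<ge> N \<Longrightarrow> b \<otimes>\<^bsub>K\<^esub> (emb u [^]\<^bsub>K\<^esub> m) \<in> M"
          using M b(1) u powM unfolding mathieu_subspace_def by (meson A.smult_closed K.one_closed)
        \<comment> \<open>\<open>Suc N\<close> is an exponent that is both at least \<open>N\<close> and positive.\<close>
        obtain r where r: "r \<in> carrier R" "s = r \<otimes> u [^] Suc N"
          using sdiv[of "Suc N"] by auto
        have "y = emb (r \<otimes> u [^] Suc N) \<otimes>\<^bsub>K\<^esub> b"
          using b(1) r sc smult_eq_mult[OF sc b(1)] b(2) by simp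
        also have "\<dots> = emb r \<otimes>\<^bsub>K\<^esub> (b \<otimes>\<^bsub>K\<^esub> (emb u [^]\<^bsub>K\<^esub> Suc N))"
          using b(1) r(1) u
          by (simp add: emb_mult emb_pow K.m_ac del: nat_pow_Suc K.nat_pow_Suc)
        also have "\<dots> = r \<odot>\<^bsub>K\<^esub> (b \<otimes>\<^bsub>K\<^esub> (emb u [^]\<^bsub>K\<^esub> Suc N))"
          using b(1) r(1) u by (intro smult_eq_mult[symmetric]) auto
        also have "\<dots> \<in> M" using subE(4)[OF r(1) N[of "Suc N"]] by simp
        finally show ?thesis .
      qed
      with \<open>M \<noteq> carrier K\<close> subE(1) show False by blast
    qed
  qed
qed

section \<open>The maximal ideal of the localization at a prime\<close>

text \<open>
  This is \<open>P R\<^sub>P\<close> as a subset of \<open>K\<close>.  Describing \<open>x = p / s\<close> by the equation \<open>s x = p\<close> keeps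
  inverses out of the computations.
\<close>

definition localized_ideal :: "'a set \<Rightarrow> 'b set" where
  "localized_ideal P = {x \<in> carrier K. \<exists>s \<in> carrier R - P. \<exists>p \<in> P. s \<odot>\<^bsub>K\<^esub> x = emb p}"

lemma localized_idealI:
  "x \<in> carrier K \<Longrightarrow> s \<in> carrier R - P \<Longrightarrow> p \<in> P \<Longrightarrow> s \<odot>\<^bsub>K\<^esub> x = emb p \<Longrightarrow> x \<in> localized_ideal P"
  unfolding localized_ideal_def by blast

lemma localized_idealE:
  assumes "x \<in> localized_ideal P"
  obtains s p where "x \<in> carrier K" "s \<in> carrier R" "s \<notin> P" "p \<in> P" "s \<odot>\<^bsub>K\<^esub> x = emb p"
  using assms unfolding localized_ideal_def by blast

lemma emb_in_localized_ideal:
  assumes "primeideal P R" "p \<in> P"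
  shows "emb p \<in> localized_ideal P"
proof -
  have "p \<in> carrier R" using primeideal.axioms(1)[OF assms(1)] assms(2) by (rule ideal.Icarr)
  then show ?thesis
    using primeideal.one_notin[OF assms(1)] assms(2)
    by (intro localized_idealI[of _ \<one> P p]) auto
qed

lemma one_notin_localized_ideal:
  assumes P: "primeideal P R"
  shows "\<one>\<^bsub>K\<^esub> \<notin> localized_ideal P"
proof
  interpret P: primeideal P R by (rule P)
  assume "\<one>\<^bsub>K\<^esub> \<in> localized_ideal P"
  then obtain s p where "s \<in> carrier R" "s \<notin> P" "p \<in> P" "emb s = emb p"
    by (rule localized_idealE)
  moreover from this have "s = p" using inj_onD[OF inj] P.Icarr by blast
  ultimately show False by blast
qed

lemma submodule_localized_ideal:
  assumes P: "primeideal P R"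
  shows "submodule (localized_ideal P) R K"
proof (rule A.submoduleI)
  interpret P: primeideal P R by (rule P)
  show "localized_ideal P \<subseteq> carrier K" unfolding localized_ideal_def by blast
  show "\<zero>\<^bsub>K\<^esub> \<in> localized_ideal P"
    using emb_in_localized_ideal[OF P P.zero_closed] by simp
  show smult: "r \<odot>\<^bsub>K\<^esub> x \<in> localized_ideal P"
    if r: "r \<in> carrier R" and x: "x \<in> localized_ideal P" for r x
    using x
  proof (rule localized_idealE)
    fix s p assume sp: "x \<in> carrier K" "s \<in> carrier R" "s \<notin> P" "p \<in> P" "s \<odot>\<^bsub>K\<^esub> x = emb p"
    have "s \<odot>\<^bsub>K\<^esub> (r \<odot>\<^bsub>K\<^esub> x) = (r \<otimes> s) \<odot>\<^bsub>K\<^esub> x"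
      using r sp A.smult_assoc1[of s r x] m_comm[of s r] by simp
    also have "\<dots> = emb (r \<otimes> p)"
      using r sp P.Icarr by (simp add: A.smult_assoc1)
    finally show ?thesis
      using r sp P.I_l_closed by (intro localized_idealI[of _ s P "r \<otimes> p"]) auto
  qed
  show "\<ominus>\<^bsub>K\<^esub> x \<in> localized_ideal P" if x: "x \<in> localized_ideal P" for x
  proof -
    have "x \<in> carrier K" using x by (rule localized_idealE)
    then have "(\<ominus> \<one>) \<odot>\<^bsub>K\<^esub> x = \<ominus>\<^bsub>K\<^esub> x" by (simp add: A.smult_l_minus)
    with smult[of "\<ominus> \<one>", OF _ x] show ?thesis by simp
  qed
  show "x \<oplus>\<^bsub>K\<^esub> y \<in> localized_ideal P"
    if x: "x \<in> localized_ideal P" and y: "y \<in> localized_ideal P" for x y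
  proof -
    obtain s p where sp: "x \<in> carrier K" "s \<in> carrier R" "s \<notin> P" "p \<in> P" "s \<odot>\<^bsub>K\<^esub> x = emb p"
      using x by (rule localized_idealE)
    obtain t q where tq: "y \<in> carrier K" "t \<in> carrier R" "t \<notin> P" "q \<in> P" "t \<odot>\<^bsub>K\<^esub> y = emb q"
      using y by (rule localized_idealE)
    have pq: "p \<in> carrier R" "q \<in> carrier R" using sp tq P.Icarr by auto
    have "(s \<otimes> t) \<odot>\<^bsub>K\<^esub> x = emb (t \<otimes> p)"
      using sp tq pq m_comm[of s t] by (simp add: A.smult_assoc1)
    moreover have "(s \<otimes> t) \<odot>\<^bsub>K\<^esub> y = emb (s \<otimes> q)"
      using sp tq pq by (simp add: A.smult_assoc1)
    ultimately have "(s \<otimes> t) \<odot>\<^bsub>K\<^esub> (x \<oplus>\<^bsub>K\<^esub> y) = emb (t \<otimes> p \<oplus> s \<otimes> q)"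
      using sp tq pq by (simp add: A.smult_r_distr A.smult_l_distr)
    moreover have "s \<otimes> t \<in> carrier R - P" using sp tq P.I_prime by blast
    moreover have "t \<otimes> p \<oplus> s \<otimes> q \<in> P"
      using sp tq by (intro P.a_closed P.I_l_closed)
    ultimately show ?thesis using sp tq by (intro localized_idealI) auto
  qed
qed

text \<open>
  Write \<open>a = p / s\<close> and \<open>b = u / v\<close>, and choose \<open>t \<notin> P\<close> and \<open>n\<close> with \<open>t p\<^sup>n = r v\<close>.  Then for
  \<open>m > n\<close> the product \<open>b a\<^sup>m\<close> equals \<open>r u p\<^sup>m\<^sup>-\<^sup>n / (t s\<^sup>m)\<close>, whose numerator is in \<open>P\<close> and whose
  denominator is not.
\<close>

lemma mathieu_subspace_localized_ideal:
  assumes P: "primeideal P R" and ht: "height R P = 1"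
  shows "mathieu_subspace R K (localized_ideal P)"
  unfolding mathieu_subspace_def
proof (intro conjI ballI impI)
  show "submodule (localized_ideal P) R K" using P by (rule submodule_localized_ideal)
next
  interpret P: primeideal P R by (rule P)
  fix a b assume a: "a \<in> carrier K" and b: "b \<in> carrier K"
    and pow: "\<forall>m::nat. m \<ge> 1 \<longrightarrow> a [^]\<^bsub>K\<^esub> m \<in> localized_ideal P"
  have "a \<in> localized_ideal P" using pow[rule_format, of 1] a by simp
  then obtain s p where s: "s \<in> carrier R" "s \<notin> P" and p: "p \<in> P" and sa: "s \<odot>\<^bsub>K\<^esub> a = emb p"
    by (rule localized_idealE)
  have pc: "p \<in> carrier R" using p by (rule P.Icarr)
  obtain u v where u: "u \<in> carrier R" and v: "v \<in> carrier R" "v \<noteq> \<zero>"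
    and vb: "v \<odot>\<^bsub>K\<^esub> b = emb u"
    using b by (rule exists_denominator)
  obtain t n r where t: "t \<in> carrier R - P" and r: "r \<in> carrier R"
    and tp: "t \<otimes> p [^] (n::nat) = r \<otimes> v"
    using P ht p v by (rule height_one_power_multiple)
  have "b \<otimes>\<^bsub>K\<^esub> (a [^]\<^bsub>K\<^esub> m) \<in> localized_ideal P" if m: "m \<ge> Suc n" for m
  proof -
    obtain k where k: "m = n + Suc k"
      using le_Suc_ex[OF m] by auto
    show ?thesis
    proof (rule localized_idealI)
      have spow: "s [^] j \<notin> P" for j :: nat
        using s P.I_prime[of "s [^] i" s for i] P.one_notin by (induction j) auto
      show "t \<otimes> s [^] m \<in> carrier R - P" using t s spow P.I_prime by blast
      show "b \<otimes>\<^bsub>K\<^esub> (a [^]\<^bsub>K\<^esub> m) \<in> carrier K" using a b by simp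
      have pk: "p [^] Suc k \<in> P" using p pc P.I_l_closed by simp
      then show "(r \<otimes> u) \<otimes> p [^] Suc k \<in> P" using r u P.I_l_closed by blast
      have sam: "emb s [^]\<^bsub>K\<^esub> m \<otimes>\<^bsub>K\<^esub> a [^]\<^bsub>K\<^esub> m = emb (p [^] m)"
        using a s pc sa by (simp add: K.nat_pow_distrib[symmetric] emb_pow smult_eq_mult[of s a])
      have "(t \<otimes> s [^] m) \<odot>\<^bsub>K\<^esub> (b \<otimes>\<^bsub>K\<^esub> (a [^]\<^bsub>K\<^esub> m))
          = emb t \<otimes>\<^bsub>K\<^esub> emb s [^]\<^bsub>K\<^esub> m \<otimes>\<^bsub>K\<^esub> (b \<otimes>\<^bsub>K\<^esub> (a [^]\<^bsub>K\<^esub> m))"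
        using a b s t by (subst smult_eq_mult) (simp_all add: emb_mult emb_pow)
      also have "\<dots> = b \<otimes>\<^bsub>K\<^esub> (emb t \<otimes>\<^bsub>K\<^esub> (emb s [^]\<^bsub>K\<^esub> m \<otimes>\<^bsub>K\<^esub> a [^]\<^bsub>K\<^esub> m))"
        using a b s t by (simp add: K.m_ac)
      also have "\<dots> = b \<otimes>\<^bsub>K\<^esub> emb (t \<otimes> p [^] m)"
        using t pc unfolding sam by (simp add: emb_mult)
      also have "t \<otimes> p [^] m = v \<otimes> (r \<otimes> p [^] Suc k)"
      proof -
        have "t \<otimes> p [^] m = (t \<otimes> p [^] n) \<otimes> p [^] Suc k"
          using t pc unfolding k by (simp add: nat_pow_mult[symmetric] m_assoc del: nat_pow_Suc)
        then show ?thesis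
          using r v pc unfolding tp by (simp add: m_ac)
      qed
      also have "b \<otimes>\<^bsub>K\<^esub> emb (v \<otimes> (r \<otimes> p [^] Suc k)) = (emb v \<otimes>\<^bsub>K\<^esub> b) \<otimes>\<^bsub>K\<^esub> emb (r \<otimes> p [^] Suc k)"
        using b v r pc emb_mult[of v "r \<otimes> p [^] Suc k"] by (simp add: K.m_ac del: nat_pow_Suc)
      also have "\<dots> = emb u \<otimes>\<^bsub>K\<^esub> emb (r \<otimes> p [^] Suc k)"
        using vb smult_eq_mult[OF v(1) b] by simp
      also have "\<dots> = emb ((r \<otimes> u) \<otimes> p [^] Suc k)"
      proof -
        have "(r \<otimes> u) \<otimes> p [^] Suc k = u \<otimes> (r \<otimes> p [^] Suc k)"
          using u r pc by (simp add: m_ac del: nat_pow_Suc)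
        then show ?thesis using emb_mult[of u "r \<otimes> p [^] Suc k"] u r pc by (simp del: nat_pow_Suc)
      qed
      finally show "(t \<otimes> s [^] m) \<odot>\<^bsub>K\<^esub> (b \<otimes>\<^bsub>K\<^esub> (a [^]\<^bsub>K\<^esub> m)) = emb ((r \<otimes> u) \<otimes> p [^] Suc k)" .
    qed
  qed
  then show "\<exists>N::nat. \<forall>m\<ge>N. b \<otimes>\<^bsub>K\<^esub> (a [^]\<^bsub>K\<^esub> m) \<in> localized_ideal P" by blast
qed

lemma strongly_simple_imp_no_height_one:
  assumes ss: "strongly_simple R K" and P: "primeideal P R"
  shows "height R P \<noteq> 1"
proof
  interpret P: primeideal P R by (rule P)
  assume ht: "height R P = 1"
  obtain p where p: "p \<in> P" "p \<noteq> \<zero>"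
    using height_one_nonzero[OF ht] P.zero_closed by blast
  then have "emb p \<noteq> \<zero>\<^bsub>K\<^esub>" using emb_nonzero[of p] P.Icarr by (simp add: K.field_Units)
  then have "localized_ideal P \<noteq> {\<zero>\<^bsub>K\<^esub>}"
    using emb_in_localized_ideal[OF P p(1)] by blast
  moreover have "localized_ideal P \<noteq> carrier K"
    using one_notin_localized_ideal[OF P] by blast
  ultimately show False
    using ss mathieu_subspace_localized_ideal[OF P ht] unfolding strongly_simple_def by blast
qed

end

theorem corollary4p4:
  fixes R :: "('a, 'c) ring_scheme"
    and K :: "('a, 'b, 'd) module_scheme"
  assumes "domain R"
    and "is_fraction_field R K"
  shows "(anti_Archimedean R \<longrightarrow> strongly_simple R K) \<and>
         (strongly_simple R K \<longrightarrow> \<not> (\<exists>P. primeideal P R \<and> height R P = 1))"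
proof -
  interpret domain R by (rule assms(1))
  interpret K: field K using assms(2) by (simp add: is_fraction_field_def)
  interpret A: algebra R K using assms(2) by (simp add: is_fraction_field_def)
  interpret fraction_field R K
    by unfold_locales (use assms(2) in \<open>auto simp: is_fraction_field_def\<close>)
  show ?thesis
    using anti_Archimedean_imp_strongly_simple strongly_simple_imp_no_height_one by blast
qed

end
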